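(* For all integers $n\ge 0$ and $k$, $$\mathfrak B_{2n}^{(k)}=\sum_{m=0}^n\left\{ {n \atop m} \right\}_2\frac{(-1)^{n-m}(2m)!}{(2m+1)^k}.$$
   Context: The Stirling numbers of the second kind with level $2$, $\left\{ {n \atop k} \right\}_2$ ($n,k\ge0$), are defined by $\left\{ {n \atop k} \right\}_2=\left\{ {n-1 \atop k-1} \right\}_2+k^2\left\{ {n-1 \atop k} \right\}_2$ with $\left\{ {0 \atop 0} \right\}_2=1$ and $\left\{ {n \atop 0} \right\}_2=\left\{ {0 \atop n} \right\}_2=0$ for $n\ge1$. For an integer $k$, the poly-Bernoulli numbers with level $2$, $\mathfrak B_n^{(k)}$, are defined by the power series identity $$\sum_{n=0}^\infty\mathfrak B_n^{(k)}\frac{x^n}{n!}=\frac{{\rm Li}_{2,k}\bigl(2\sin(x/2)\bigr)}{2\sin(x/2)}=\sum_{m=0}^\infty\frac{\bigl(2\sin(x/2)\bigr)^{2m}}{(2m+1)^k},$$ where ${\rm Li}_{2,k}(z)=\sum_{n=0}^\infty\frac{z^{2n+1}}{(2n+1)^k}$. *)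

theory Defs
  imports Complex_Main "HOL-Computational_Algebra.Formal_Power_Series"
begin

fun stirling_level2 :: "nat \<Rightarrow> nat \<Rightarrow> nat" where
  "stirling_level2 0 0 = 1"
| "stirling_level2 0 (Suc k) = 0"
| "stirling_level2 (Suc n) 0 = 0"
| "stirling_level2 (Suc n) (Suc k) =
     stirling_level2 n k + (Suc k)\<^sup>2 * stirling_level2 n (Suc k)"

definition polylog_level2 :: "int \<Rightarrow> real fps" where
  "polylog_level2 k = Abs_fps (\<lambda>j. if odd j then 1 / (of_nat j) powi k else 0)"

(* The power series 2 sin (x / 2). *)
definition two_sin_half :: "real fps" where
  "two_sin_half = fps_const 2 * fps_sin (1 / 2)"

(* Generating functions are read as formal power series. The quotient of formal power
   series is exact here: numerator and denominator both have subdegree 1. *)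
definition poly_bernoulli_level2 :: "nat \<Rightarrow> int \<Rightarrow> real" where
  "poly_bernoulli_level2 n k =
     fact n * fps_nth (fps_compose (polylog_level2 k) two_sin_half / two_sin_half) n"

lemma two_sin_half_nth_0: "fps_nth two_sin_half 0 = 0"
  by (simp add: two_sin_half_def)

lemma two_sin_half_nonzero: "two_sin_half \<noteq> 0"
proof
  assume "two_sin_half = 0"
  hence "fps_nth two_sin_half 1 = 0" by simp
  thus False by (simp add: two_sin_half_def fps_sin_def)
qed

(* The second form of the generating function,
   the sum over m of (2 sin (x / 2)) ^ (2 m) / (2 m + 1) ^ k. *)
lemma polylog_level2_compose_div:
  "fps_compose (polylog_level2 k) two_sin_half / two_sin_half =
   fps_compose (Abs_fps (\<lambda>j. if even j then 1 / (of_nat (j + 1)) powi k else 0)) two_sin_half"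
proof -
  let ?G = "Abs_fps (\<lambda>j. if even j then 1 / (of_nat (j + 1)) powi k else 0) :: real fps"
  have "polylog_level2 k = ?G * fps_X"
    by (rule fps_ext) (auto simp: polylog_level2_def)
  hence "fps_compose (polylog_level2 k) two_sin_half = fps_compose ?G two_sin_half * two_sin_half"
    by (simp add: fps_compose_mult_distrib two_sin_half_nth_0)
  thus ?thesis
    by (simp add: two_sin_half_nonzero)
qed

end

theory Submission
  imports Defs
begin

text \<open>
  The series \<open>S = 2 sin (x / 2)\<close> satisfies \<open>S'\<^sup>2 = 1 - S\<^sup>2 / 4\<close> and \<open>S'' = - S / 4\<close>, so
  \<open>(S\<^bsup>2m\<^esup>)'' = 2m (2m - 1) S\<^bsup>2m-2\<^esup> - m\<^sup>2 S\<^bsup>2m\<^esup>\<close>. On coefficients this is, up to sign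
  and the factor \<open>(2m)!\<close>, the recurrence of the Stirling numbers with level 2.
\<close>

lemma fps_deriv_two_sin_half: "fps_deriv two_sin_half = fps_cos (1 / 2)"
  by (simp add: two_sin_half_def fps_sin_deriv flip: mult.assoc)

lemma fps_deriv2_two_sin_half:
  "fps_deriv (fps_cos (1 / 2)) = - fps_const (1 / 4) * two_sin_half"
  by (rule fps_ext) (simp add: two_sin_half_def fps_cos_deriv)

lemma fps_cos_half_squared:
  "(fps_cos (1 / 2))\<^sup>2 = 1 - fps_const (1 / 4) * two_sin_half\<^sup>2"
proof -
  have "fps_const (1 / 4) * two_sin_half\<^sup>2 = (fps_sin (1 / 2))\<^sup>2"
    by (simp add: two_sin_half_def power_mult_distrib fps_const_power flip: mult.assoc)
  with fps_sin_cos_sum_of_squares [of "1 / 2 :: real"] show ?thesis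
    by (simp add: algebra_simps)
qed

text \<open>Differentiate twice by the chain rule and eliminate the squared cosine. The exponent
  \<open>2 * Suc m\<close> avoids truncated subtraction in the lowered exponent.\<close>

lemma fps_deriv2_two_sin_half_power:
  "fps_deriv (fps_deriv (two_sin_half ^ (2 * Suc m))) =
     fps_const ((2 * real m + 2) * (2 * real m + 1)) * two_sin_half ^ (2 * m) -
     fps_const ((real m + 1)\<^sup>2) * two_sin_half ^ (2 * Suc m)"
proof -
  let ?S = two_sin_half and ?C = "fps_cos (1 / 2) :: real fps"
  have 1: "fps_deriv (?S ^ (2 * Suc m)) = fps_const (2 * real m + 2) * (?C * ?S ^ Suc (2 * m))"
    by (simp add: fps_deriv_power fps_deriv_two_sin_half mult_ac add_ac del: power_Suc)
  have "fps_deriv (?S ^ Suc (2 * m)) = fps_const (2 * real m + 1) * ?C * ?S ^ (2 * m)"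
    by (simp add: fps_deriv_power fps_deriv_two_sin_half mult_ac add_ac del: power_Suc)
  hence "fps_deriv (?C * ?S ^ Suc (2 * m)) =
      fps_const (2 * real m + 1) * ?C\<^sup>2 * ?S ^ (2 * m)
      - fps_const (1 / 4) * ?S ^ (2 * Suc m)"
    unfolding fps_deriv_mult fps_deriv2_two_sin_half
    by (simp add: power2_eq_square mult_ac del: fps_deriv_mult flip: fps_const_neg)
  \<comment> \<open>Replacing \<open>?C\<^sup>2\<close> by 1 - S^2/4 raises part of the first term
    to exponent 2m + 2, where it joins the term coming from the derivative of
    \<open>?C\<close>.\<close>
  also have "\<dots> = fps_const (2 * real m + 1) * ?S ^ (2 * m)
      - (fps_const (2 * real m + 1) * fps_const (1 / 4) + fps_const (1 / 4)) * ?S ^ (2 * Suc m)"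
    unfolding fps_cos_half_squared by (simp add: algebra_simps power2_eq_square del: fps_const_mult fps_const_add)
  also have "fps_const (2 * real m + 1) * fps_const (1 / 4) + fps_const (1 / 4)
      = fps_const ((real m + 1) / 2)"
    unfolding fps_const_mult fps_const_add
    by (rule arg_cong [where f = fps_const]) (simp add: field_simps)
  finally have "fps_deriv (?C * ?S ^ Suc (2 * m)) =
      fps_const (2 * real m + 1) * ?S ^ (2 * m)
      - fps_const ((real m + 1) / 2) * ?S ^ (2 * Suc m)" .
  hence "fps_deriv (fps_deriv (?S ^ (2 * Suc m))) =
      fps_const ((2 * real m + 2) * (2 * real m + 1)) * ?S ^ (2 * m)
      - fps_const ((2 * real m + 2) * ((real m + 1) / 2)) * ?S ^ (2 * Suc m)"
    unfolding 1 fps_deriv_mult_const_left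
    by (simp only: right_diff_distrib mult.assoc flip: fps_const_mult)
  also have "(2 * real m + 2) * ((real m + 1) / 2) = (real m + 1)\<^sup>2"
    by (simp add: power2_eq_square field_simps)
  finally show ?thesis .
qed

text \<open>Both sides obey the same recurrence in n, which links m to m - 1, hence the induction
  with m arbitrary. The sign has exponent n + m so that no bound on m is needed; for m > n both
  sides vanish.\<close>

lemma two_sin_half_power_nth:
  "fact (2 * n) * fps_nth (two_sin_half ^ (2 * m)) (2 * n) =
     (- 1) ^ (n + m) * fact (2 * m) * real (stirling_level2 n m)"
proof (induction n arbitrary: m)
  case 0
  show ?case
    by (cases m) (simp_all add: fps_power_zeroth two_sin_half_nth_0)
next
  case (Suc n)
  show ?case
  proof (cases m)
    case 0
    thus ?thesis by simp
  next
    case (Suc l)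
    let ?a = "\<lambda>j. fact (2 * n) * fps_nth (two_sin_half ^ (2 * j)) (2 * n)"
    \<comment> \<open>Coefficients scaled by factorials are shifted by differentiation, here by two
      places.\<close>
    have "fact (2 * Suc n) * fps_nth (two_sin_half ^ (2 * m)) (2 * Suc n) =
        fact (2 * n) * fps_nth (fps_deriv (fps_deriv (two_sin_half ^ (2 * Suc l)))) (2 * n)"
      by (simp add: Suc algebra_simps del: power_Suc)
    also have "\<dots> = (2 * real l + 2) * (2 * real l + 1) * ?a l - (real l + 1)\<^sup>2 * ?a (Suc l)"
      unfolding fps_deriv2_two_sin_half_power by (simp add: algebra_simps del: power_Suc)
    \<comment> \<open>With m = l + 1, the factor (2l + 2)(2l + 1) turns (2l)! into (2m)!. The signs
      agree: n + l and n + 1 + m differ by 2, and the minus before the second term accounts for the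
      step from n + m to n + 1 + m.\<close>
    also have "\<dots> = (- 1) ^ (Suc n + m) * fact (2 * m) * real (stirling_level2 (Suc n) m)"
      unfolding Suc.IH by (simp add: Suc power2_eq_square algebra_simps)
    finally show ?thesis .
  qed
qed

theorem theorem4:
  fixes n :: nat and k :: int
  shows "poly_bernoulli_level2 (2 * n) k =
    (\<Sum>m = 0..n. real (stirling_level2 n m) *
       ((- 1) ^ (n - m) * fact (2 * m) / real (2 * m + 1) powi k))"
proof -
  let ?g = "\<lambda>i. fact (2 * n) * ((if even i then 1 / real (i + 1) powi k else 0) *
    fps_nth (two_sin_half ^ i) (2 * n))"
  have "poly_bernoulli_level2 (2 * n) k = (\<Sum>i = 0..2 * n. ?g i)"
    unfolding poly_bernoulli_level2_def polylog_level2_compose_div fps_compose_nth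
    by (simp add: sum_distrib_left)
  \<comment> \<open>The outer series is even, so odd indices contribute nothing.\<close>
  also have "\<dots> = (\<Sum>i\<in>(\<lambda>m. 2 * m) ` {0..n}. ?g i)"
    by (rule sum.mono_neutral_right) (auto simp: image_iff elim!: evenE)
  also have "\<dots> = (\<Sum>m = 0..n. ?g (2 * m))"
    by (subst sum.reindex) (auto simp: inj_on_def)
  also have "\<dots> = (\<Sum>m = 0..n. real (stirling_level2 n m) *
       ((- 1) ^ (n - m) * fact (2 * m) / real (2 * m + 1) powi k))"
  proof (rule sum.cong [OF refl])
    fix m assume "m \<in> {0..n}"
    \<comment> \<open>Since m is at most n, the subtraction is not truncated and n - m has the
      parity of n + m.\<close>
    hence "(- 1 :: real) ^ (n - m) = (- 1) ^ (n + m)"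
      by (simp add: minus_one_power_iff)
    moreover have "?g (2 * m) = (fact (2 * n) * fps_nth (two_sin_half ^ (2 * m)) (2 * n))
        / real (2 * m + 1) powi k"
      by simp
    ultimately show "?g (2 * m) = real (stirling_level2 n m) *
        ((- 1) ^ (n - m) * fact (2 * m) / real (2 * m + 1) powi k)"
      unfolding two_sin_half_power_nth by simp
  qed
  finally show ?thesis .
qed

end
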